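(* Let $\Pi:R\to R$ and $\delta:R\to R$ be $K$-linear operators and let $\alpha,\beta\in R$ be elements such that for all $x,y\in R$: (1) $\Pi^2=\Pi$ and $\delta\Pi=\delta$; (2) $\delta(\Pi x\,\Pi y)=(\delta x)(\Pi y)+(\Pi x)(\delta y)-\alpha(\delta x)(\delta y)$; (3) $\Pi\bigl((\Pi x)(\Pi y)\bigr)=(\Pi x)(\Pi y)+\beta(\delta x)(\delta y)$. Then the operation $$\mu(x,y)=\Pi\bigl((\Pi x)(\Pi y)\bigr)=(\Pi x)(\Pi y)+\beta(\delta x)(\delta y)$$ is an associative product structure on $R$.
   Context: $K$ is a commutative associative ring with unit, $R\supset K$ is a commutative associative ring with the same unit, and both are integral domains. Products such as $\delta\Pi$ and $\Pi^2$ denote composition of operators. *)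

theory Defs
  imports "HOL-Algebra.Subrings"
begin

text \<open>
  The ring \<open>R\<close> is regarded as a module over a subring \<open>K\<close>, with scalar multiplication given by the
  multiplication of \<open>R\<close>. All conditions are relativised to \<open>carrier R\<close>; values outside it are
  irrelevant.
\<close>

definition linear_operator :: "'a set \<Rightarrow> ('a, 'm) ring_scheme \<Rightarrow> ('a \<Rightarrow> 'a) \<Rightarrow> bool" where
  "linear_operator K R f \<longleftrightarrow>
     f \<in> carrier R \<rightarrow> carrier R \<and>
     (\<forall>x \<in> carrier R. \<forall>y \<in> carrier R. f (x \<oplus>\<^bsub>R\<^esub> y) = f x \<oplus>\<^bsub>R\<^esub> f y) \<and>
     (\<forall>k \<in> K. \<forall>x \<in> carrier R. f (k \<otimes>\<^bsub>R\<^esub> x) = k \<otimes>\<^bsub>R\<^esub> f x)"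

definition bilinear_operation :: "'a set \<Rightarrow> ('a, 'm) ring_scheme \<Rightarrow> ('a \<Rightarrow> 'a \<Rightarrow> 'a) \<Rightarrow> bool" where
  "bilinear_operation K R m \<longleftrightarrow>
     (\<forall>x \<in> carrier R. linear_operator K R (\<lambda>y. m x y)) \<and>
     (\<forall>y \<in> carrier R. linear_operator K R (\<lambda>x. m x y))"

text \<open>
  An associative product structure on the \<open>K\<close>-module \<open>R\<close> is an associative \<open>K\<close>-bilinear operation;
  no unit element is required.
\<close>

definition associative_product :: "'a set \<Rightarrow> ('a, 'm) ring_scheme \<Rightarrow> ('a \<Rightarrow> 'a \<Rightarrow> 'a) \<Rightarrow> bool" where
  "associative_product K R m \<longleftrightarrow>
     bilinear_operation K R m \<and>
     (\<forall>x \<in> carrier R. \<forall>y \<in> carrier R. \<forall>z \<in> carrier R. m (m x y) z = m x (m y z))"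

end

theory Submission
  imports Defs
begin

text \<open>Applying \<open>P\<close> or \<open>\<delta>\<close> to \<open>\<mu> x y\<close> gives a
  polynomial in the values of \<open>P\<close> and \<open>\<delta>\<close> at \<open>x\<close> and
  \<open>y\<close>: since \<open>P\<close> is idempotent and \<open>\<delta>\<close> absorbs
  \<open>P\<close>, the outer \<open>P\<close> in \<open>\<mu>\<close> does no harm
  (\<open>P\<mu>\<close>, \<open>\<delta>\<mu>\<close>). Substituting these into the formula for
  \<open>\<mu>\<close> turns \<open>\<mu> (\<mu> x y) z\<close> into a polynomial that is symmetric
  in the three arguments (\<open>expand\<close>). As \<open>\<mu>\<close> is commutative, this
  symmetry is associativity. Bilinearity holds because, with one argument fixed,
  \<open>\<mu>\<close> is a composite of linear operators.\<close>

lemma linear_operator_comp: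
  assumes "linear_operator K R f" and "linear_operator K R g"
  shows "linear_operator K R (\<lambda>x. f (g x))"
  using assms unfolding linear_operator_def Pi_iff by metis

lemma (in cring) linear_operator_mult:
  assumes "a \<in> carrier R" and "K \<subseteq> carrier R"
  shows "linear_operator K R (\<lambda>x. a \<otimes> x)"
  using assms by (auto simp: linear_operator_def r_distr m_lcomm)

lemma linear_operator_cong:
  fixes R (structure)
  assumes "ring R" and "K \<subseteq> carrier R"
    and "\<And>x. x \<in> carrier R \<Longrightarrow> f x = g x"
    and "linear_operator K R g"
  shows "linear_operator K R f"
proof -
  interpret ring R by fact
  show ?thesis
    using assms unfolding linear_operator_def by (auto simp: Pi_iff subset_iff)
qed

theorem theorem3:
  fixes R :: "('a, 'm) ring_scheme" (structure)
    and K :: "'a set"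
    and P \<delta> :: "'a \<Rightarrow> 'a"
    and \<alpha> \<beta> :: 'a
    and \<mu> :: "'a \<Rightarrow> 'a \<Rightarrow> 'a"
  assumes "domain R" and "subdomain K R"
    and "linear_operator K R P" and "linear_operator K R \<delta>"
    and "\<alpha> \<in> carrier R" and "\<beta> \<in> carrier R"
    and "\<And>x. x \<in> carrier R \<Longrightarrow> (P \<circ> P) x = P x"
    and "\<And>x. x \<in> carrier R \<Longrightarrow> (\<delta> \<circ> P) x = \<delta> x"
    and "\<And>x y. \<lbrakk>x \<in> carrier R; y \<in> carrier R\<rbrakk> \<Longrightarrow>
           \<delta> (P x \<otimes> P y) = (\<delta> x \<otimes> P y \<oplus> P x \<otimes> \<delta> y) \<ominus> \<alpha> \<otimes> (\<delta> x \<otimes> \<delta> y)"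
    and "\<And>x y. \<lbrakk>x \<in> carrier R; y \<in> carrier R\<rbrakk> \<Longrightarrow>
           P (P x \<otimes> P y) = P x \<otimes> P y \<oplus> \<beta> \<otimes> (\<delta> x \<otimes> \<delta> y)"
    and "\<And>x y. \<lbrakk>x \<in> carrier R; y \<in> carrier R\<rbrakk> \<Longrightarrow> \<mu> x y = P (P x \<otimes> P y)"
  shows "associative_product K R \<mu>"
proof -
  interpret domain R by fact
  have K: "K \<subseteq> carrier R"
    using subdomainE(1)[OF assms(2)] .
  have PC: "P x \<in> carrier R" and DC: "\<delta> x \<in> carrier R" if "x \<in> carrier R" for x
    using assms(3,4) that by (auto simp: linear_operator_def)
  have \<mu>C: "\<mu> x y \<in> carrier R" if "x \<in> carrier R" "y \<in> carrier R" for x y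
    using that by (simp add: assms(11) PC)
  have comm: "\<mu> x y = \<mu> y x" if "x \<in> carrier R" "y \<in> carrier R" for x y
    using that by (simp add: assms(11) PC m_comm)
  have lin: "linear_operator K R (\<lambda>y. \<mu> x y)" if x: "x \<in> carrier R" for x
  proof (rule linear_operator_cong[OF ring_axioms K])
    show "\<mu> x y = P (P x \<otimes> P y)" if "y \<in> carrier R" for y
      using assms(11)[OF x that] .
    show "linear_operator K R (\<lambda>y. P (P x \<otimes> P y))"
      \<comment> \<open>The map is \<open>P\<close>, followed by multiplication by
        \<open>P x\<close>, followed by \<open>P\<close> again.\<close>
      by (intro linear_operator_comp[OF assms(3)]
          linear_operator_comp[OF linear_operator_mult assms(3)] PC x K)
  qed
  have lin': "linear_operator K R (\<lambda>x. \<mu> x y)" if "y \<in> carrier R" for y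
    \<comment> \<open>Commutativity reduces linearity in the first argument to linearity in the
      second.\<close>
    by (rule linear_operator_cong[OF ring_axioms K comm lin]) (use that in auto)
  have P\<mu>: "P (\<mu> x y) = P x \<otimes> P y \<oplus> \<beta> \<otimes> (\<delta> x \<otimes> \<delta> y)"
    and \<delta>\<mu>: "\<delta> (\<mu> x y) = (\<delta> x \<otimes> P y \<oplus> P x \<otimes> \<delta> y) \<ominus> \<alpha> \<otimes> (\<delta> x \<otimes> \<delta> y)"
    if "x \<in> carrier R" "y \<in> carrier R" for x y
    \<comment> \<open>Idempotence and absorption, taken at the product
      \<open>P x \<otimes> P y\<close>, remove the \<open>P\<close> inside \<open>\<mu> x y\<close>;
      the product laws for \<open>P\<close> and \<open>\<delta>\<close> then apply.\<close>
    using assms(7,8)[of "P x \<otimes> P y"] that by (simp_all add: assms(9-11) PC)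
  have expand: "\<mu> (\<mu> x y) z =
      P x \<otimes> P y \<otimes> P z
      \<oplus> \<beta> \<otimes> (\<delta> x \<otimes> \<delta> y \<otimes> P z \<oplus> \<delta> x \<otimes> P y \<otimes> \<delta> z \<oplus> P x \<otimes> \<delta> y \<otimes> \<delta> z)
      \<ominus> \<alpha> \<otimes> \<beta> \<otimes> (\<delta> x \<otimes> \<delta> y \<otimes> \<delta> z)"
    if xyz: "x \<in> carrier R" "y \<in> carrier R" "z \<in> carrier R" for x y z
  proof -
    have "\<mu> (\<mu> x y) z = P (\<mu> x y) \<otimes> P z \<oplus> \<beta> \<otimes> (\<delta> (\<mu> x y) \<otimes> \<delta> z)"
      \<comment> \<open>This is the product law for \<open>P\<close> with \<open>\<mu> x y\<close>
        itself as the first argument.\<close>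
      using trans[OF assms(11) assms(10)] xyz \<mu>C by blast
    also have "\<dots> = (P x \<otimes> P y \<oplus> \<beta> \<otimes> (\<delta> x \<otimes> \<delta> y)) \<otimes> P z
      \<oplus> \<beta> \<otimes> (((\<delta> x \<otimes> P y \<oplus> P x \<otimes> \<delta> y) \<ominus> \<alpha> \<otimes> (\<delta> x \<otimes> \<delta> y)) \<otimes> \<delta> z)"
      using xyz by (simp add: P\<mu> \<delta>\<mu>)
    finally show ?thesis
      using xyz assms(5,6) PC DC by algebra
  qed
  have assoc: "\<mu> (\<mu> x y) z = \<mu> x (\<mu> y z)"
    if xyz: "x \<in> carrier R" "y \<in> carrier R" "z \<in> carrier R" for x y z
  proof -
    \<comment> \<open>The expansion is invariant under cyclic permutation, and \<open>\<mu>\<close> is commutative.\<close>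
    have "\<mu> (\<mu> x y) z = \<mu> (\<mu> y z) x"
      unfolding expand[OF xyz] expand[OF xyz(2,3,1)]
      using xyz assms(5,6) PC DC by algebra
    then show ?thesis
      using xyz by (simp add: comm \<mu>C)
  qed
  show ?thesis
    unfolding associative_product_def bilinear_operation_def
    using lin lin' assoc by blast
qed

end
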